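(* Let $(\epsilon(n))_{n \ge 1}$ be a sequence of real numbers with $\epsilon(n) \to 0$ as $n \to \infty$. Then there exist $n_0$ and subgroups $H_n < S_n$ for all $n \ge n_0$ such that $|H_n| \ge (n!)^{\epsilon(n)}$ for all $n \ge n_0$ and the family $(S_n, H_n)_{n \ge n_0}$ is indistinguishable.
   Context: For a finite group $G$, let $\mathrm{Irr}(G)$ be its set of complex irreducible characters and $d_\chi=\chi(e)$. For $H \le G$ let $D_H = \frac{1}{|G|}\sum_{\chi \in \mathrm{Irr}(G)} d_\chi \big|\sum_{h \in H, h \neq e}\chi(h)\big|$ (the $L_1$ distance between the distributions $P_H(\chi)=\frac{d_\chi}{|G|}\sum_{h\in H}\chi(h)$ and $P_{\{e\}}$ on $\mathrm{Irr}(G)$ produced by weak quantum Fourier sampling). A family $(G_i,H_i)_{i \in I}$ with $H_i \le G_i$, $I$ an infinite set of positive integers and $|G_i| \to \infty$, is called distinguishable if there is a constant $c>0$ such that $D_{H_i} \ge (\log|G_i|)^{-c}$ for all sufficiently large $i \in I$, and indistinguishable otherwise. $S_n$ is the symmetric group on $\{1,\ldots,n\}$, $|S_n| = n!$. *)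

theory Defs
  imports "HOL-Algebra.Sym_Groups" "Jordan_Normal_Form.Matrix" Complex_Main
begin

definition mat_trace :: "complex mat \<Rightarrow> complex" where
  "mat_trace A = (\<Sum>i<dim_row A. A $$ (i, i))"

definition is_rep :: "('a, 'b) monoid_scheme \<Rightarrow> nat \<Rightarrow> ('a \<Rightarrow> complex mat) \<Rightarrow> bool" where
  "is_rep G d \<rho> \<longleftrightarrow>
     (\<forall>g \<in> carrier G. \<rho> g \<in> carrier_mat d d) \<and>
     \<rho> \<one>\<^bsub>G\<^esub> = 1\<^sub>m d \<and>
     (\<forall>g \<in> carrier G. \<forall>h \<in> carrier G. \<rho> (g \<otimes>\<^bsub>G\<^esub> h) = \<rho> g * \<rho> h)"

definition is_subspace :: "nat \<Rightarrow> complex vec set \<Rightarrow> bool" where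
  "is_subspace d W \<longleftrightarrow> W \<subseteq> carrier_vec d \<and> 0\<^sub>v d \<in> W \<and>
     (\<forall>v \<in> W. \<forall>w \<in> W. v + w \<in> W) \<and> (\<forall>c. \<forall>v \<in> W. c \<cdot>\<^sub>v v \<in> W)"

definition irreducible_rep :: "('a, 'b) monoid_scheme \<Rightarrow> nat \<Rightarrow> ('a \<Rightarrow> complex mat) \<Rightarrow> bool" where
  "irreducible_rep G d \<rho> \<longleftrightarrow> is_rep G d \<rho> \<and> d > 0 \<and>
     (\<forall>W. is_subspace d W \<and> (\<forall>g \<in> carrier G. \<forall>w \<in> W. \<rho> g *\<^sub>v w \<in> W)
          \<longrightarrow> W = {0\<^sub>v d} \<or> W = carrier_vec d)"

definition character :: "('a, 'b) monoid_scheme \<Rightarrow> ('a \<Rightarrow> complex mat) \<Rightarrow> 'a \<Rightarrow> complex" where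
  "character G \<rho> = (\<lambda>g. if g \<in> carrier G then mat_trace (\<rho> g) else 0)"

definition Irr :: "('a, 'b) monoid_scheme \<Rightarrow> ('a \<Rightarrow> complex) set" where
  "Irr G = {\<chi>. \<exists>d \<rho>. irreducible_rep G d \<rho> \<and> \<chi> = character G \<rho>}"

definition D_dist :: "('a, 'b) monoid_scheme \<Rightarrow> 'a set \<Rightarrow> real" where
  "D_dist G H = (1 / real (card (carrier G))) *
     (\<Sum>\<chi> \<in> Irr G. cmod (\<chi> \<one>\<^bsub>G\<^esub>) * cmod (\<Sum>h \<in> H - {\<one>\<^bsub>G\<^esub>}. \<chi> h))"

definition sym_distinguishable :: "nat \<Rightarrow> (nat \<Rightarrow> (nat \<Rightarrow> nat) set) \<Rightarrow> bool" where
  "sym_distinguishable n0 H \<longleftrightarrow>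
     (\<exists>c > 0. \<exists>N. \<forall>n \<ge> N. n \<ge> n0 \<longrightarrow>
        D_dist (sym_group n) (H n) \<ge> ln (real (card (carrier (sym_group n)))) powr (- c))"

end

theory Submission
  imports Defs "Jordan_Normal_Form.Spectral_Radius" "HOL-Analysis.L2_Norm"
begin

text \<open>Irreducible characters are orthonormal, so Bessel's inequality for the indicator function of
  the conjugacy class \<open>C\<close> of \<open>h\<close> gives \<open>\<Sum>\<chi>. |\<chi> h|\<^sup>2 \<le> |G| / |C|\<close>, and the Cauchy--Schwarz inequality
  bounds \<open>D_H\<close> by the sum of \<open>|C|\<^sup>-\<^sup>1\<^sup>/\<^sup>2\<close> over the nontrivial \<open>h \<in> H\<close>.

  Let \<open>S\<^sub>k\<close> act diagonally on \<open>m = 6 L\<close> copies of \<open>{1..k}\<close>. A permutation with support of size \<open>s\<close>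
  then moves \<open>s m\<close> of the \<open>n = k m\<close> points, so its conjugacy class in \<open>S\<^sub>n\<close> has at least \<open>k\<close> to the
  power \<open>2 L s\<close> elements, and \<open>D_H\<close> is at most of the order of \<open>k\<close> to the power \<open>2 - L\<close>. On the other
  hand \<open>k!\<close> is at least \<open>n!\<close> to the power \<open>1 / (24 L)\<close> once \<open>k \<ge> 6 L\<close>. Since \<open>\<epsilon>(n)\<close> tends to \<open>0\<close>,
  any fixed \<open>L\<close> is admissible for large \<open>k\<close>; so taking for \<open>H\<^sub>n\<close> a subgroup minimising \<open>D_H\<close> among
  all sufficiently large ones makes \<open>D_H\<close> beat every fixed power of \<open>1 / log n!\<close> infinitely often.\<close>

section \<open>Schur's lemma\<close>

lemma index_mult_mat_sum:
  fixes A B :: "'a :: semiring_0 mat"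
  assumes "A \<in> carrier_mat n m" "B \<in> carrier_mat m p" "i < n" "j < p"
  shows "(A * B) $$ (i, j) = (\<Sum>k<m. A $$ (i, k) * B $$ (k, j))"
  using assms by (auto simp: times_mat_def scalar_prod_def lessThan_atLeast0)

lemma mat_trace_comm:
  assumes A: "A \<in> carrier_mat n m" and B: "B \<in> carrier_mat m n"
  shows "mat_trace (A * B) = mat_trace (B * A)"
proof -
  have "mat_trace (A * B) = (\<Sum>i<n. \<Sum>k<m. A $$ (i, k) * B $$ (k, i))"
    unfolding mat_trace_def using assms
    by (intro sum.cong) (auto simp: index_mult_mat_sum[OF A B] simp del: index_mult_mat(1))
  also have "\<dots> = (\<Sum>k<m. \<Sum>i<n. B $$ (k, i) * A $$ (i, k))"
    by (subst sum.swap) (simp add: mult.commute)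
  also have "\<dots> = mat_trace (B * A)"
    unfolding mat_trace_def using assms
    by (intro sum.cong) (auto simp: index_mult_mat_sum[OF B A] simp del: index_mult_mat(1))
  finally show ?thesis .
qed

lemma is_rep_carrier: "is_rep G d \<rho> \<Longrightarrow> g \<in> carrier G \<Longrightarrow> \<rho> g \<in> carrier_mat d d"
  and is_rep_one: "is_rep G d \<rho> \<Longrightarrow> \<rho> \<one>\<^bsub>G\<^esub> = 1\<^sub>m d"
  and is_rep_mult: "is_rep G d \<rho> \<Longrightarrow> g \<in> carrier G \<Longrightarrow> h \<in> carrier G \<Longrightarrow>
        \<rho> (g \<otimes>\<^bsub>G\<^esub> h) = \<rho> g * \<rho> h"
  by (auto simp: is_rep_def)

lemma is_rep_mult_index:
  assumes "is_rep G d \<rho>" "g \<in> carrier G" "h \<in> carrier G" "i < d" "j < d"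
  shows "\<rho> (g \<otimes>\<^bsub>G\<^esub> h) $$ (i, j) = (\<Sum>k<d. \<rho> g $$ (i, k) * \<rho> h $$ (k, j))"
  using assms
  by (simp add: is_rep_mult index_mult_mat_sum[OF is_rep_carrier is_rep_carrier] del: index_mult_mat(1))

lemma irreducible_repD:
  assumes "irreducible_rep G d \<rho>"
  shows "is_rep G d \<rho>" "d > 0"
    "is_subspace d W \<Longrightarrow> (\<And>g w. g \<in> carrier G \<Longrightarrow> w \<in> W \<Longrightarrow> \<rho> g *\<^sub>v w \<in> W) \<Longrightarrow>
       W = {0\<^sub>v d} \<or> W = carrier_vec d"
  using assms by (auto simp: irreducible_rep_def)

text \<open>The kernel \<open>K\<close> and the range \<open>R\<close> of \<open>T\<close> are
  invariant subspaces, so if \<open>T\<close> is nonzero irreducibility leaves only \<open>K\<close>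
  trivial and \<open>R\<close> the whole space. The conclusion offers a two-sided inverse, so
  \<open>d\<close> and \<open>e\<close> need not be compared first.\<close>

lemma Schur:
  assumes \<rho>: "irreducible_rep G d \<rho>" and \<sigma>: "irreducible_rep G e \<sigma>"
    and T: "T \<in> carrier_mat e d"
    and comm: "\<And>g. g \<in> carrier G \<Longrightarrow> \<sigma> g * T = T * \<rho> g"
  shows "T = 0\<^sub>m e d \<or> (\<exists>S \<in> carrier_mat d e. T * S = 1\<^sub>m e \<and> S * T = 1\<^sub>m d)"
proof (cases "T = 0\<^sub>m e d")
  case False
  note \<rho>c = is_rep_carrier[OF irreducible_repD(1)[OF \<rho>]]
  note \<sigma>c = is_rep_carrier[OF irreducible_repD(1)[OF \<sigma>]]
  have comm_vec: "\<sigma> g *\<^sub>v (T *\<^sub>v v) = T *\<^sub>v (\<rho> g *\<^sub>v v)"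
    if "g \<in> carrier G" "v \<in> carrier_vec d" for g v
    using that comm[of g] \<rho>c[of g] \<sigma>c[of g] T by (metis assoc_mult_mat_vec)
  define K where "K = {v \<in> carrier_vec d. T *\<^sub>v v = 0\<^sub>v e}"
  define R where "R = (\<lambda>v. T *\<^sub>v v) ` carrier_vec d"
  have nz: "\<exists>v \<in> carrier_vec d. T *\<^sub>v v \<noteq> 0\<^sub>v e"
  proof (rule ccontr)
    assume "\<not> ?thesis"
    then have z: "\<And>v. v \<in> carrier_vec d \<Longrightarrow> T *\<^sub>v v = 0\<^sub>v e" by blast
    have "T = 0\<^sub>m e d"
    proof (rule eq_matI)
      fix i j assume ij: "i < dim_row (0\<^sub>m e d)" "j < dim_col (0\<^sub>m e d)"
      have "T *\<^sub>v unit_vec d j = 0\<^sub>v e" by (rule z) simp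
      then have "(T *\<^sub>v unit_vec d j) $ i = 0" using ij by simp
      then show "T $$ (i, j) = 0\<^sub>m e d $$ (i, j)" using T ij by simp
    qed (use T in auto)
    with False show False ..
  qed
  have "is_subspace d K"
    unfolding is_subspace_def K_def using T
    by (auto simp: mult_add_distrib_mat_vec[of _ e d] mult_mat_vec[of _ e d])
  moreover have "\<rho> g *\<^sub>v w \<in> K" if "g \<in> carrier G" "w \<in> K" for g w
    using that comm_vec[of g w, symmetric] \<rho>c[of g] \<sigma>c[of g]
    by (auto simp: K_def)
  ultimately have "K = {0\<^sub>v d} \<or> K = carrier_vec d"
    by (rule irreducible_repD(3)[OF \<rho>])
  with nz have K: "K = {0\<^sub>v d}" by (auto simp: K_def)
  have "is_subspace e R"
    unfolding is_subspace_def
  proof (intro conjI ballI allI)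
    show "R \<subseteq> carrier_vec e" using T by (auto simp: R_def)
    show "0\<^sub>v e \<in> R" using T by (auto simp: R_def intro!: image_eqI[of _ _ "0\<^sub>v d"])
    fix v assume "v \<in> R"
    then obtain v' where v': "v' \<in> carrier_vec d" "v = T *\<^sub>v v'" by (auto simp: R_def)
    show "c \<cdot>\<^sub>v v \<in> R" for c
      using v' T by (auto simp: R_def mult_mat_vec[of _ e d] intro!: image_eqI[of _ _ "c \<cdot>\<^sub>v v'"])
    fix w assume "w \<in> R"
    then obtain w' where w': "w' \<in> carrier_vec d" "w = T *\<^sub>v w'" by (auto simp: R_def)
    show "v + w \<in> R"
      using v' w' T
      by (auto simp: R_def mult_add_distrib_mat_vec[of _ e d] intro!: image_eqI[of _ _ "v' + w'"])
  qed
  moreover have "\<sigma> g *\<^sub>v w \<in> R" if "g \<in> carrier G" "w \<in> R" for g w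
    using that comm_vec[of g] \<rho>c[of g] by (auto simp: R_def)
  ultimately have "R = {0\<^sub>v e} \<or> R = carrier_vec e"
    by (rule irreducible_repD(3)[OF \<sigma>])
  with nz have R: "R = carrier_vec e" by (auto simp: R_def)
  have "\<forall>i. \<exists>w. w \<in> carrier_vec d \<and> T *\<^sub>v w = unit_vec e i"
  proof
    fix i
    have "unit_vec e i \<in> R" using R by simp
    then show "\<exists>w. w \<in> carrier_vec d \<and> T *\<^sub>v w = unit_vec e i"
      unfolding R_def by (metis imageE)
  qed
  then obtain w where w: "\<And>i. w i \<in> carrier_vec d" "\<And>i. T *\<^sub>v w i = unit_vec e i"
    by metis
  \<comment> \<open>The columns of \<open>S\<close> are preimages of the unit vectors, which makes
    \<open>S\<close> a right inverse of \<open>T\<close>.\<close>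
  define S where "S = mat d e (\<lambda>(p, i). w i $ p)"
  have S: "S \<in> carrier_mat d e" by (simp add: S_def)
  have colS: "col S i = w i" if "i < e" for i
    using that w(1)[of i] by (auto simp: S_def)
  have TS: "T * S = 1\<^sub>m e"
  proof (rule eq_matI)
    fix i j assume ij: "i < dim_row (1\<^sub>m e)" "j < dim_col (1\<^sub>m e)"
    have "(T * S) $$ (i, j) = (T *\<^sub>v w j) $ i"
      using ij T S by (simp add: colS)
    then show "(T * S) $$ (i, j) = 1\<^sub>m e $$ (i, j)"
      using ij by (simp add: w(2))
  qed (use T S in auto)
  \<comment> \<open>The right inverse is also a left inverse because \<open>T\<close> is injective:
    \<open>S * T *\<^sub>v v\<close> and \<open>v\<close> have the same image under
    \<open>T\<close>.\<close>
  have STv: "S * T *\<^sub>v v = v" if v: "v \<in> carrier_vec d" for v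
  proof -
    have "T *\<^sub>v (S * T *\<^sub>v v) = (T * (S * T)) *\<^sub>v v"
      by (rule assoc_mult_mat_vec[symmetric]) (use T S v in auto)
    also have "T * (S * T) = T"
      using T S TS by (metis assoc_mult_mat left_mult_one_mat)
    finally have "T *\<^sub>v (S * T *\<^sub>v v - v) = 0\<^sub>v e"
      using T S v by (subst mult_minus_distrib_mat_vec[of _ e d]) auto
    then have "S * T *\<^sub>v v - v \<in> K" using T S v by (auto simp: K_def)
    with K have "S * T *\<^sub>v v - v = 0\<^sub>v d" by auto
    then have "\<forall>i<d. (S * T *\<^sub>v v - v) $ i = 0" by simp
    then show ?thesis using S T v by (intro eq_vecI) auto
  qed
  have "S * T = 1\<^sub>m d"
  proof (rule eq_matI)
    fix i j assume ij: "i < dim_row (1\<^sub>m d)" "j < dim_col (1\<^sub>m d)"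
    have "(S * T *\<^sub>v unit_vec d j) $ i = unit_vec d j $ i"
      using STv by simp
    moreover have "T *\<^sub>v unit_vec d j = col T j"
      using T ij by (intro eq_vecI) auto
    ultimately show "(S * T) $$ (i, j) = 1\<^sub>m d $$ (i, j)" using ij S T by auto
  qed (use S T in auto)
  with TS S show ?thesis by blast
qed simp

text \<open>Over the complex numbers \<open>T\<close> has an eigenvalue \<open>c\<close>. The matrix
  \<open>T - c I\<close> still commutes with the representation but kills an eigenvector, so it is
  not invertible and must vanish.\<close>

lemma Schur_scalar:
  assumes \<rho>: "irreducible_rep G d \<rho>" and T: "T \<in> carrier_mat d d"
    and comm: "\<And>g. g \<in> carrier G \<Longrightarrow> \<rho> g * T = T * \<rho> g"
  shows "\<exists>c. T = c \<cdot>\<^sub>m 1\<^sub>m d"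
proof -
  obtain c where "c \<in> spectrum T"
    using spectrum_non_empty[OF T] irreducible_repD(2)[OF \<rho>] by blast
  then obtain v where v: "v \<in> carrier_vec d" "v \<noteq> 0\<^sub>v d" "T *\<^sub>v v = c \<cdot>\<^sub>v v"
    using T by (auto simp: spectrum_def eigenvalue_def eigenvector_def)
  define T' where "T' = T - c \<cdot>\<^sub>m 1\<^sub>m d"
  have T': "T' \<in> carrier_mat d d" using T by (auto simp: T'_def)
  have "\<rho> g * T' = T' * \<rho> g" if g: "g \<in> carrier G" for g
  proof -
    have "\<rho> g \<in> carrier_mat d d"
      using is_rep_carrier[OF irreducible_repD(1)[OF \<rho>] g] .
    then show ?thesis
      using T comm[OF g]
      by (simp add: T'_def mult_minus_distrib_mat[of _ d d] minus_mult_distrib_mat[of _ d d]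
          mult_smult_distrib[of _ d d _ d] mult_smult_assoc_mat[of _ d d _ d])
  qed
  from Schur[OF \<rho> \<rho> T' this] show ?thesis
  proof
    assume z: "T' = 0\<^sub>m d d"
    have "T = c \<cdot>\<^sub>m 1\<^sub>m d"
    proof (rule eq_matI)
      fix i j assume "i < dim_row (c \<cdot>\<^sub>m 1\<^sub>m d :: complex mat)" "j < dim_col (c \<cdot>\<^sub>m 1\<^sub>m d :: complex mat)"
      then have ij: "i < d" "j < d" by auto
      then have "T' $$ (i, j) = 0" by (simp add: z)
      then show "T $$ (i, j) = (c \<cdot>\<^sub>m 1\<^sub>m d) $$ (i, j)" using ij T by (simp add: T'_def)
    qed (use T in auto)
    then show ?thesis ..
  next
    assume "\<exists>S \<in> carrier_mat d d. T' * S = 1\<^sub>m d \<and> S * T' = 1\<^sub>m d"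
    then obtain S where S: "S \<in> carrier_mat d d" "S * T' = 1\<^sub>m d" by blast
    have "T' *\<^sub>v v = 0\<^sub>v d"
      using v T by (auto simp: T'_def minus_mult_distrib_mat_vec[of _ d d])
    then have "S *\<^sub>v (T' *\<^sub>v v) = 0\<^sub>v d" using S by auto
    moreover have "S *\<^sub>v (T' *\<^sub>v v) = v"
      using assoc_mult_mat_vec[OF S(1) T' v(1)] S(2) v(1) by simp
    ultimately show ?thesis using v(2) by simp
  qed
qed

section \<open>Orthogonality of irreducible characters\<close>

text \<open>The matrix unit with its 1 at position \<open>(i, j)\<close>, made equivariant by
  summing its translates \<open>\<sigma> g E \<rho> (inv g)\<close> over the group. The sum is not
  divided by the group order.\<close>

definition intertwiner ::
  "('a, 'b) monoid_scheme \<Rightarrow> nat \<Rightarrow> ('a \<Rightarrow> complex mat) \<Rightarrow> nat \<Rightarrow> ('a \<Rightarrow> complex mat) \<Rightarrow> nat \<Rightarrow> nat \<Rightarrow> complex mat"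
  where "intertwiner G e \<sigma> d \<rho> i j =
    mat e d (\<lambda>(k, l). \<Sum>g\<in>carrier G. \<sigma> g $$ (k, i) * \<rho> (inv\<^bsub>G\<^esub> g) $$ (j, l))"

lemma intertwiner_carrier [simp]: "intertwiner G e \<sigma> d \<rho> i j \<in> carrier_mat e d"
  by (simp add: intertwiner_def)

lemma (in group) sum_translate_left:
  assumes "x \<in> carrier G"
  shows "(\<Sum>g\<in>carrier G. f (x \<otimes> g)) = (\<Sum>g\<in>carrier G. f g)"
  by (rule sum.reindex_bij_witness[of _ "\<lambda>g. inv x \<otimes> g" "\<lambda>g. x \<otimes> g"])
     (use assms in \<open>auto simp: m_assoc[symmetric]\<close>)

lemma (in group) sum_translate_right:
  assumes "x \<in> carrier G"
  shows "(\<Sum>g\<in>carrier G. f (g \<otimes> x)) = (\<Sum>g\<in>carrier G. f g)"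
  by (rule sum.reindex_bij_witness[of _ "\<lambda>g. g \<otimes> inv x" "\<lambda>g. g \<otimes> x"])
     (use assms in \<open>auto simp: m_assoc\<close>)

lemma (in group) intertwiner_comm:
  assumes \<sigma>: "is_rep G e \<sigma>" and \<rho>: "is_rep G d \<rho>" and x: "x \<in> carrier G"
    and i: "i < e" and j: "j < d"
  shows "\<sigma> x * intertwiner G e \<sigma> d \<rho> i j = intertwiner G e \<sigma> d \<rho> i j * \<rho> x"
proof (rule eq_matI)
  let ?T = "intertwiner G e \<sigma> d \<rho> i j"
  note xc = is_rep_carrier[OF \<sigma> x] is_rep_carrier[OF \<rho> x]
  fix k l assume "k < dim_row (?T * \<rho> x)" "l < dim_col (?T * \<rho> x)"
  then have kl: "k < e" "l < d" using xc by (auto simp: intertwiner_def)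
  have "(\<sigma> x * ?T) $$ (k, l) =
      (\<Sum>p<e. \<Sum>g\<in>carrier G. \<sigma> x $$ (k, p) * (\<sigma> g $$ (p, i) * \<rho> (inv g) $$ (j, l)))"
    using kl
    by (subst index_mult_mat_sum[OF xc(1) intertwiner_carrier])
       (auto simp: intertwiner_def sum_distrib_left)
  also have "\<dots> = (\<Sum>g\<in>carrier G. \<sigma> (x \<otimes> g) $$ (k, i) * \<rho> (inv g) $$ (j, l))"
    by (subst sum.swap)
       (intro sum.cong, use x i kl in
         \<open>auto simp: is_rep_mult_index[OF \<sigma>] sum_distrib_right mult.assoc\<close>)
  \<comment> \<open>Writing \<open>inv g\<close> as \<open>inv (x g) x\<close> makes the summand a
    function of \<open>x g\<close>, so that left translation invariance applies.\<close>
  also have "\<dots> = (\<Sum>g\<in>carrier G. \<sigma> (x \<otimes> g) $$ (k, i) * \<rho> (inv (x \<otimes> g) \<otimes> x) $$ (j, l))"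
    by (intro sum.cong) (use x in \<open>auto simp: inv_mult_group m_assoc\<close>)
  also have "\<dots> = (\<Sum>g\<in>carrier G. \<sigma> g $$ (k, i) * \<rho> (inv g \<otimes> x) $$ (j, l))"
    by (rule sum_translate_left[OF x])
  also have "\<dots> = (\<Sum>p<d. \<Sum>g\<in>carrier G. (\<sigma> g $$ (k, i) * \<rho> (inv g) $$ (j, p)) * \<rho> x $$ (p, l))"
    by (subst sum.swap)
       (intro sum.cong, use x j kl in
         \<open>auto simp: is_rep_mult_index[OF \<rho>] sum_distrib_left mult.assoc\<close>)
  also have "\<dots> = (?T * \<rho> x) $$ (k, l)"
    using kl
    by (subst index_mult_mat_sum[OF intertwiner_carrier xc(2)])
       (auto simp: intertwiner_def sum_distrib_right)
  finally show "(\<sigma> x * ?T) $$ (k, l) = (?T * \<rho> x) $$ (k, l)" .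
qed (use is_rep_carrier[OF \<sigma> x] is_rep_carrier[OF \<rho> x] in \<open>auto simp: intertwiner_def\<close>)

lemma character_eq:
  assumes "is_rep G d \<rho>" "g \<in> carrier G"
  shows "character G \<rho> g = (\<Sum>i<d. \<rho> g $$ (i, i))"
  using assms is_rep_carrier[OF assms] by (simp add: character_def mat_trace_def)

text \<open>Expanding both traces produces exactly the \<open>(i, j)\<close> entries of the
  \<open>(i, j)\<close> intertwiners. Both orthogonality relations thereby reduce to Schur's
  lemma.\<close>

lemma (in group) sum_character_eq_intertwiner:
  assumes \<sigma>: "is_rep G e \<sigma>" and \<rho>: "is_rep G d \<rho>"
  shows "(\<Sum>g\<in>carrier G. character G \<sigma> g * character G \<rho> (inv g)) =
     (\<Sum>i<e. \<Sum>j<d. intertwiner G e \<sigma> d \<rho> i j $$ (i, j))"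
proof -
  have "(\<Sum>g\<in>carrier G. character G \<sigma> g * character G \<rho> (inv g)) =
     (\<Sum>g\<in>carrier G. \<Sum>i<e. \<Sum>j<d. \<sigma> g $$ (i, i) * \<rho> (inv g) $$ (j, j))"
    by (intro sum.cong) (auto simp: character_eq[OF \<sigma>] character_eq[OF \<rho>] sum_product)
  also have "\<dots> = (\<Sum>i<e. \<Sum>g\<in>carrier G. \<Sum>j<d. \<sigma> g $$ (i, i) * \<rho> (inv g) $$ (j, j))"
    by (rule sum.swap)
  also have "\<dots> = (\<Sum>i<e. \<Sum>j<d. \<Sum>g\<in>carrier G. \<sigma> g $$ (i, i) * \<rho> (inv g) $$ (j, j))"
    by (intro sum.cong refl sum.swap)
  also have "\<dots> = (\<Sum>i<e. \<Sum>j<d. intertwiner G e \<sigma> d \<rho> i j $$ (i, j))"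
    by (intro sum.cong refl) (simp add: intertwiner_def)
  finally show ?thesis .
qed

text \<open>A nonzero intertwiner would be invertible by Schur's lemma, hence the two
  representations similar and their characters equal. So all intertwiners vanish.\<close>

lemma (in group) character_orthogonal:
  assumes \<sigma>: "irreducible_rep G e \<sigma>" and \<rho>: "irreducible_rep G d \<rho>"
    and ne: "character G \<sigma> \<noteq> character G \<rho>"
  shows "(\<Sum>g\<in>carrier G. character G \<sigma> g * character G \<rho> (inv g)) = 0"
proof -
  note r = irreducible_repD(1)[OF \<sigma>] irreducible_repD(1)[OF \<rho>]
  have "intertwiner G e \<sigma> d \<rho> i j = 0\<^sub>m e d" if ij: "i < e" "j < d" for i j
  proof (rule ccontr)
    let ?T = "intertwiner G e \<sigma> d \<rho> i j"
    assume "?T \<noteq> 0\<^sub>m e d"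
    then obtain S where S: "S \<in> carrier_mat d e" "?T * S = 1\<^sub>m e" "S * ?T = 1\<^sub>m d"
      using Schur[OF \<rho> \<sigma> intertwiner_carrier intertwiner_comm[OF r _ ij]] by blast
    have "character G \<sigma> g = character G \<rho> g" for g
    proof (cases "g \<in> carrier G")
      case g: True
      note c = is_rep_carrier[OF r(1) g] is_rep_carrier[OF r(2) g]
      have T: "?T \<in> carrier_mat e d" by simp
      have "mat_trace (\<sigma> g) = mat_trace (\<sigma> g * (?T * S))"
        using S(2) c by simp
      also have "\<sigma> g * (?T * S) = \<sigma> g * ?T * S"
        using assoc_mult_mat[OF c(1) T S(1)] ..
      also have "\<dots> = ?T * \<rho> g * S"
        by (simp only: intertwiner_comm[OF r g ij])
      also have "mat_trace \<dots> = mat_trace (S * (?T * \<rho> g))"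
        by (rule mat_trace_comm[OF mult_carrier_mat[OF T c(2)] S(1)])
      also have "S * (?T * \<rho> g) = S * ?T * \<rho> g"
        using assoc_mult_mat[OF S(1) T c(2)] ..
      also have "\<dots> = \<rho> g" using S(3) c by simp
      finally show ?thesis using g by (simp add: character_def)
    qed (simp add: character_def)
    then show False using ne by blast
  qed
  then show ?thesis
    by (simp add: sum_character_eq_intertwiner[OF r])
qed

text \<open>Each intertwiner is a scalar \<open>c\<close>, and its trace determines it:
  \<open>c d\<close> is the sum over \<open>g\<close> of the \<open>(j, i)\<close> entry of
  \<open>\<rho> (inv g g)\<close>, which is the group order if \<open>i = j\<close> and 0
  otherwise.\<close>

lemma (in group) character_norm:
  assumes \<rho>: "irreducible_rep G d \<rho>" and fin: "finite (carrier G)"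
  shows "(\<Sum>g\<in>carrier G. character G \<rho> g * character G \<rho> (inv g)) = of_nat (card (carrier G))"
proof -
  note r = irreducible_repD(1)[OF \<rho>]
  have d: "d > 0" by (rule irreducible_repD(2)[OF \<rho>])
  let ?T = "intertwiner G d \<rho> d \<rho>"
  have "?T i j $$ (i, j) = (if i = j then of_nat (card (carrier G)) / of_nat d else 0)"
    if ij: "i < d" "j < d" for i j
  proof -
    obtain c where c: "?T i j = c \<cdot>\<^sub>m 1\<^sub>m d"
      using Schur_scalar[OF \<rho> intertwiner_carrier intertwiner_comm[OF r r _ ij]] by blast
    have "c * of_nat d = (\<Sum>k<d. ?T i j $$ (k, k))"
      by (simp add: c)
    also have "\<dots> = (\<Sum>k<d. \<Sum>g\<in>carrier G. \<rho> (inv g) $$ (j, k) * \<rho> g $$ (k, i))"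
      by (intro sum.cong) (auto simp: intertwiner_def mult.commute)
    also have "\<dots> = (\<Sum>g\<in>carrier G. \<rho> (inv g \<otimes> g) $$ (j, i))"
      by (subst sum.swap) (intro sum.cong refl is_rep_mult_index[OF r, symmetric], use ij in auto)
    also have "\<dots> = (if i = j then of_nat (card (carrier G)) else 0)"
      using ij by (simp add: is_rep_one[OF r])
    finally show ?thesis using ij d by (auto simp: c field_simps)
  qed
  then show ?thesis
    using d by (simp add: sum_character_eq_intertwiner[OF r r])
qed

section \<open>Characters at conjugates and inverses\<close>

lemma (in group) character_conj:
  assumes r: "is_rep G d \<rho>" and g: "g \<in> carrier G" and h: "h \<in> carrier G"
  shows "character G \<rho> (g \<otimes> h \<otimes> inv g) = character G \<rho> h"
proof -
  note c = is_rep_carrier[OF r]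
  have "mat_trace (\<rho> (g \<otimes> h \<otimes> inv g)) = mat_trace (\<rho> (g \<otimes> h) * \<rho> (inv g))"
    using g h by (simp add: is_rep_mult[OF r])
  also have "\<dots> = mat_trace (\<rho> (inv g) * \<rho> (g \<otimes> h))"
    by (rule mat_trace_comm[OF c c]) (use g h in auto)
  also have "\<rho> (inv g) * \<rho> (g \<otimes> h) = \<rho> h"
    using g h by (simp add: is_rep_mult[OF r, symmetric] m_assoc[symmetric])
  finally show ?thesis using g h by (simp add: character_def)
qed

text \<open>The matrix \<open>P\<close> below is the Gram matrix of a \<open>G\<close>-invariant inner product, which makes
  \<open>\<rho> (inv x)\<close> similar to the conjugate transpose of \<open>\<rho> x\<close>.\<close>

lemma (in group) character_inv:
  assumes r: "is_rep G d \<rho>" and fin: "finite (carrier G)" and x: "x \<in> carrier G"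
  shows "character G \<rho> (inv x) = cnj (character G \<rho> x)"
proof -
  note c = is_rep_carrier[OF r]
  define P where "P = mat d d (\<lambda>(k, l). \<Sum>g\<in>carrier G. \<Sum>p<d. cnj (\<rho> g $$ (p, k)) * \<rho> g $$ (p, l))"
  define R where "R = mat d d (\<lambda>(i, j). cnj (\<rho> x $$ (j, i)))"
  have P: "P \<in> carrier_mat d d" and R: "R \<in> carrier_mat d d"
    by (simp_all add: P_def R_def)
  have X: "\<rho> (inv x) \<in> carrier_mat d d" using x c by simp
  have PR: "P * \<rho> (inv x) = R * P"
  proof (rule eq_matI)
    fix k l assume "k < dim_row (R * P)" "l < dim_col (R * P)"
    then have kl: "k < d" "l < d" using P R by auto
    have "(P * \<rho> (inv x)) $$ (k, l) =
        (\<Sum>q<d. \<Sum>g\<in>carrier G. \<Sum>p<d. cnj (\<rho> g $$ (p, k)) * \<rho> g $$ (p, q) * \<rho> (inv x) $$ (q, l))"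
      using kl by (subst index_mult_mat_sum[OF P X]) (auto simp: P_def sum_distrib_right)
    also have "\<dots> = (\<Sum>g\<in>carrier G. \<Sum>p<d. \<Sum>q<d. cnj (\<rho> g $$ (p, k)) * \<rho> g $$ (p, q) * \<rho> (inv x) $$ (q, l))"
      by (subst sum.swap) (intro sum.cong refl sum.swap)
    also have "\<dots> = (\<Sum>g\<in>carrier G. \<Sum>p<d. cnj (\<rho> g $$ (p, k)) * \<rho> (g \<otimes> inv x) $$ (p, l))"
      by (intro sum.cong refl)
         (use x kl in \<open>auto simp: is_rep_mult_index[OF r] sum_distrib_left mult.assoc\<close>)
    \<comment> \<open>Right translation by \<open>x\<close> turns \<open>g\<close> into
      \<open>g x\<close>: the second factor then loses its \<open>inv x\<close>, and the first one
      acquires the \<open>x\<close> that yields \<open>R\<close>.\<close>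
    also have "\<dots> = (\<Sum>g\<in>carrier G. \<Sum>p<d. cnj (\<rho> (g \<otimes> x) $$ (p, k)) * \<rho> (g \<otimes> x \<otimes> inv x) $$ (p, l))"
      by (rule sum_translate_right[OF x, symmetric])
    also have "\<dots> = (\<Sum>g\<in>carrier G. \<Sum>p<d. \<Sum>q<d. cnj (\<rho> x $$ (q, k)) * (cnj (\<rho> g $$ (p, q)) * \<rho> g $$ (p, l)))"
      by (intro sum.cong refl)
         (use x kl in \<open>auto simp: is_rep_mult_index[OF r] sum_distrib_left sum_distrib_right
            m_assoc mult_ac\<close>)
    also have "\<dots> = (\<Sum>q<d. \<Sum>g\<in>carrier G. \<Sum>p<d. cnj (\<rho> x $$ (q, k)) * (cnj (\<rho> g $$ (p, q)) * \<rho> g $$ (p, l)))"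
      by (subst (2) sum.swap) (intro sum.cong refl sum.swap)
    also have "\<dots> = (R * P) $$ (k, l)"
      using kl by (subst index_mult_mat_sum[OF R P]) (auto simp: P_def R_def sum_distrib_left)
    finally show "(P * \<rho> (inv x)) $$ (k, l) = (R * P) $$ (k, l)" .
  qed (use P R X in auto)
  \<comment> \<open>If \<open>P v = 0\<close>, then pairing with \<open>v\<close> shows that the
    squared norms of all vectors \<open>\<rho> g v\<close>, here \<open>w g\<close>, sum to 0. The
    term of the neutral element gives \<open>v = 0\<close>.\<close>
  have "det P \<noteq> 0"
  proof
    assume "det P = 0"
    then obtain v where v: "v \<in> carrier_vec d" "v \<noteq> 0\<^sub>v d" "P *\<^sub>v v = 0\<^sub>v d"
      using det_0_iff_vec_prod_zero[OF P] by blast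
    define w where "w = (\<lambda>g p. \<Sum>l<d. \<rho> g $$ (p, l) * v $ l)"
    have Pv: "(\<Sum>l<d. P $$ (k, l) * v $ l) = 0" if "k < d" for k
    proof -
      have "(P *\<^sub>v v) $ k = (\<Sum>l<d. P $$ (k, l) * v $ l)"
        using that P v(1) by (auto simp: scalar_prod_def lessThan_atLeast0)
      with v(3) that show ?thesis by (metis index_zero_vec(1))
    qed
    have "(\<Sum>g\<in>carrier G. \<Sum>p<d. cnj (w g p) * w g p) =
       (\<Sum>g\<in>carrier G. \<Sum>p<d. \<Sum>k<d. \<Sum>l<d. cnj (v $ k) * (cnj (\<rho> g $$ (p, k)) * \<rho> g $$ (p, l) * v $ l))"
      unfolding w_def cnj_sum sum_product complex_cnj_mult
      by (intro sum.cong refl) (simp only: mult_ac)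
    also have "\<dots> = (\<Sum>g\<in>carrier G. \<Sum>k<d. \<Sum>p<d. \<Sum>l<d. cnj (v $ k) * (cnj (\<rho> g $$ (p, k)) * \<rho> g $$ (p, l) * v $ l))"
      by (intro sum.cong refl sum.swap)
    also have "\<dots> = (\<Sum>g\<in>carrier G. \<Sum>k<d. \<Sum>l<d. \<Sum>p<d. cnj (v $ k) * (cnj (\<rho> g $$ (p, k)) * \<rho> g $$ (p, l) * v $ l))"
      by (intro sum.cong refl sum.swap)
    also have "\<dots> = (\<Sum>k<d. \<Sum>g\<in>carrier G. \<Sum>l<d. \<Sum>p<d. cnj (v $ k) * (cnj (\<rho> g $$ (p, k)) * \<rho> g $$ (p, l) * v $ l))"
      by (rule sum.swap)
    also have "\<dots> = (\<Sum>k<d. \<Sum>l<d. \<Sum>g\<in>carrier G. \<Sum>p<d. cnj (v $ k) * (cnj (\<rho> g $$ (p, k)) * \<rho> g $$ (p, l) * v $ l))"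
      by (intro sum.cong refl sum.swap)
    also have "\<dots> = (\<Sum>k<d. cnj (v $ k) * (\<Sum>l<d. P $$ (k, l) * v $ l))"
      by (intro sum.cong refl) (simp add: P_def sum_distrib_left sum_distrib_right)
    also have "\<dots> = 0" by (simp add: Pv)
    finally have "complex_of_real (\<Sum>g\<in>carrier G. \<Sum>p<d. (cmod (w g p))\<^sup>2) = 0"
      by (simp add: complex_norm_square mult.commute del: of_real_power)
    then have "(\<Sum>g\<in>carrier G. \<Sum>p<d. (cmod (w g p))\<^sup>2) = 0"
      by (simp only: of_real_eq_0_iff)
    then have "(\<Sum>p<d. (cmod (w \<one> p))\<^sup>2) = 0"
      using sum_nonneg_eq_0_iff[OF fin, of "\<lambda>g. \<Sum>p<d. (cmod (w g p))\<^sup>2"]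
      by (simp add: sum_nonneg)
    then have w0: "w \<one> p = 0" if "p < d" for p
      using that sum_nonneg_eq_0_iff[of "{..<d}" "\<lambda>p. (cmod (w \<one> p))\<^sup>2"] by simp
    have "v = 0\<^sub>v d"
    proof (rule eq_vecI)
      fix p assume "p < dim_vec (0\<^sub>v d :: complex vec)"
      then have p: "p < d" by simp
      have "w \<one> p = (\<Sum>l<d. if p = l then v $ l else 0)"
        unfolding w_def using p by (intro sum.cong refl) (auto simp: is_rep_one[OF r])
      then show "v $ p = 0\<^sub>v d $ p" using w0[OF p] p by simp
    qed (use v in simp)
    with v(2) show False ..
  qed
  then have "P \<in> Units (ring_mat TYPE(complex) d ())"
    by (rule det_non_zero_imp_unit[OF P])
  then obtain Q where Q: "Q \<in> carrier_mat d d" "Q * P = 1\<^sub>m d" "P * Q = 1\<^sub>m d"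
    unfolding Units_def ring_mat_def by auto
  have "mat_trace (\<rho> (inv x)) = mat_trace (Q * P * \<rho> (inv x))"
    using Q X by simp
  also have "Q * P * \<rho> (inv x) = Q * (R * P)"
    using assoc_mult_mat[OF Q(1) P X] by (simp only: PR)
  also have "mat_trace \<dots> = mat_trace (R * P * Q)"
    by (rule mat_trace_comm[OF Q(1) mult_carrier_mat[OF R P]])
  also have "R * P * Q = R"
    using assoc_mult_mat[OF R P Q(1)] Q(3) R by simp
  also have "mat_trace R = cnj (mat_trace (\<rho> x))"
    using c[OF x] by (simp add: mat_trace_def R_def)
  finally show ?thesis using x by (simp add: character_def)
qed

section \<open>Bessel's inequality and the class bound\<close>

text \<open>Expand the squared distance between \<open>f\<close> and its orthogonal projection
  \<open>s\<close> onto the span of \<open>F\<close>. The members of \<open>F\<close> have squared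
  norm \<open>N\<close>, whence the division by \<open>N\<close> in \<open>s\<close>. The two mixed
  terms and the squared norm of \<open>s\<close> all equal \<open>S\<close>.\<close>

lemma Bessel_inequality:
  fixes F :: "('a \<Rightarrow> complex) set" and f :: "'a \<Rightarrow> complex"
  assumes "finite F" "N > 0"
    and ortho: "\<And>a b. a \<in> F \<Longrightarrow> b \<in> F \<Longrightarrow> (\<Sum>x\<in>X. a x * cnj (b x)) = (if a = b then of_real N else 0)"
  shows "(\<Sum>a\<in>F. (cmod (\<Sum>x\<in>X. f x * cnj (a x)))\<^sup>2) \<le> N * (\<Sum>x\<in>X. (cmod (f x))\<^sup>2)"
proof -
  define c where "c = (\<lambda>a. \<Sum>x\<in>X. f x * cnj (a x))"
  define s where "s = (\<lambda>x. \<Sum>a\<in>F. c a * a x / of_real N)"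
  define S where "S = (\<Sum>a\<in>F. c a * cnj (c a)) / of_real N"
  have fs: "(\<Sum>x\<in>X. f x * cnj (s x)) = S"
  proof -
    have "(\<Sum>x\<in>X. f x * cnj (s x)) = (\<Sum>x\<in>X. \<Sum>a\<in>F. cnj (c a) / of_real N * (f x * cnj (a x)))"
      by (simp add: s_def sum_distrib_left mult_ac)
    also have "\<dots> = (\<Sum>a\<in>F. cnj (c a) / of_real N * c a)"
      by (subst sum.swap) (simp add: c_def sum_distrib_left)
    finally show ?thesis by (simp add: S_def sum_divide_distrib mult_ac)
  qed
  have "(\<Sum>x\<in>X. cnj (f x) * s x) = cnj (\<Sum>x\<in>X. f x * cnj (s x))"
    by simp
  also have "\<dots> = S" unfolding fs by (simp add: S_def mult.commute)
  finally have sf: "(\<Sum>x\<in>X. cnj (f x) * s x) = S" .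
  have ss: "(\<Sum>x\<in>X. s x * cnj (s x)) = S"
  proof -
    have "(\<Sum>x\<in>X. s x * cnj (s x)) =
        (\<Sum>x\<in>X. \<Sum>a\<in>F. \<Sum>b\<in>F. c a * cnj (c b) / (of_real N)\<^sup>2 * (a x * cnj (b x)))"
      by (simp add: s_def sum_product power2_eq_square mult_ac)
    also have "\<dots> = (\<Sum>a\<in>F. \<Sum>b\<in>F. \<Sum>x\<in>X. c a * cnj (c b) / (of_real N)\<^sup>2 * (a x * cnj (b x)))"
      by (subst sum.swap) (intro sum.cong refl sum.swap)
    also have "\<dots> = (\<Sum>a\<in>F. \<Sum>b\<in>F. if a = b then c a * cnj (c b) / of_real N else 0)"
      using \<open>N > 0\<close>
      by (intro sum.cong refl, subst sum_distrib_left[symmetric], subst ortho)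
         (auto simp: power2_eq_square)
    finally show ?thesis using \<open>finite F\<close> by (simp add: S_def sum_divide_distrib)
  qed
  have "complex_of_real (\<Sum>x\<in>X. (cmod (f x - s x))\<^sup>2) =
      (\<Sum>x\<in>X. f x * cnj (f x) - f x * cnj (s x) - cnj (f x) * s x + s x * cnj (s x))"
    unfolding of_real_sum complex_norm_square
    by (intro sum.cong refl) (simp add: algebra_simps)
  also have "\<dots> = (\<Sum>x\<in>X. f x * cnj (f x)) - S"
    by (simp add: sum.distrib sum_subtractf fs sf ss)
  also have "\<dots> = of_real ((\<Sum>x\<in>X. (cmod (f x))\<^sup>2) - (\<Sum>a\<in>F. (cmod (c a))\<^sup>2) / N)"
    by (simp add: complex_norm_square S_def del: of_real_power)
  finally have "(\<Sum>x\<in>X. (cmod (f x - s x))\<^sup>2) = (\<Sum>x\<in>X. (cmod (f x))\<^sup>2) - (\<Sum>a\<in>F. (cmod (c a))\<^sup>2) / N"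
    by (simp only: of_real_eq_iff)
  moreover have "(\<Sum>x\<in>X. (cmod (f x - s x))\<^sup>2) \<ge> 0" by (simp add: sum_nonneg)
  ultimately have "(\<Sum>a\<in>F. (cmod (c a))\<^sup>2) / N \<le> (\<Sum>x\<in>X. (cmod (f x))\<^sup>2)"
    by linarith
  then show ?thesis
    using \<open>N > 0\<close> by (simp add: c_def pos_divide_le_eq mult.commute)
qed

definition conj_class :: "('a, 'b) monoid_scheme \<Rightarrow> 'a \<Rightarrow> 'a set" where
  "conj_class G h = (\<lambda>g. g \<otimes>\<^bsub>G\<^esub> h \<otimes>\<^bsub>G\<^esub> inv\<^bsub>G\<^esub> g) ` carrier G"

text \<open>One direction of column orthogonality. The indicator \<open>f\<close> of the class has
  squared norm \<open>|C|\<close>, and its inner product with a character is \<open>|C|\<close>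
  times the conjugate of the value at \<open>h\<close>, since characters are constant on the
  class.\<close>

lemma (in group) sum_Irr_norm_square_le:
  assumes fin: "finite (carrier G)" and finI: "finite (Irr G)" and h: "h \<in> carrier G"
  shows "(\<Sum>\<chi>\<in>Irr G. (cmod (\<chi> h))\<^sup>2) \<le> card (carrier G) / card (conj_class G h)"
proof -
  let ?C = "conj_class G h" and ?N = "real (card (carrier G))"
  define f where "f = (\<lambda>x. if x \<in> ?C then 1 else 0 :: complex)"
  have C: "?C \<subseteq> carrier G" "?C \<noteq> {}" using h by (auto simp: conj_class_def)
  then have finC: "finite ?C" using fin finite_subset by blast
  then have C0: "card ?C > 0" using C by (simp add: card_gt_0_iff)
  have N0: "?N > 0" using fin one_closed by (auto simp: card_gt_0_iff)
  have ortho: "(\<Sum>x\<in>carrier G. a x * cnj (b x)) = (if a = b then of_real ?N else 0)"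
    if ab: "a \<in> Irr G" "b \<in> Irr G" for a b
  proof -
    obtain e \<sigma> where \<sigma>: "irreducible_rep G e \<sigma>" "a = character G \<sigma>"
      using ab(1) unfolding Irr_def by blast
    obtain d \<rho> where \<rho>: "irreducible_rep G d \<rho>" "b = character G \<rho>"
      using ab(2) unfolding Irr_def by blast
    have "(\<Sum>x\<in>carrier G. a x * cnj (b x)) = (\<Sum>x\<in>carrier G. a x * b (inv x))"
      by (intro sum.cong) (auto simp: \<rho>(2) character_inv[OF irreducible_repD(1)[OF \<rho>(1)] fin])
    then show ?thesis
      using character_orthogonal[OF \<sigma>(1) \<rho>(1)] character_norm[OF \<rho>(1) fin] \<sigma>(2) \<rho>(2) by auto
  qed
  have inner: "(\<Sum>x\<in>carrier G. f x * cnj (\<chi> x)) = of_nat (card ?C) * cnj (\<chi> h)"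
    if \<chi>: "\<chi> \<in> Irr G" for \<chi>
  proof -
    obtain d \<rho> where \<rho>: "irreducible_rep G d \<rho>" "\<chi> = character G \<rho>"
      using \<chi> unfolding Irr_def by blast
    have "(\<Sum>x\<in>carrier G. f x * cnj (\<chi> x)) = (\<Sum>x\<in>?C. cnj (\<chi> x))"
      using C fin by (intro sum.mono_neutral_cong_right) (auto simp: f_def)
    also have "\<dots> = (\<Sum>x\<in>?C. cnj (\<chi> h))"
      by (intro sum.cong refl)
         (auto simp: conj_class_def \<rho>(2) character_conj[OF irreducible_repD(1)[OF \<rho>(1)] _ h])
    finally show ?thesis by simp
  qed
  have "(\<Sum>x\<in>carrier G. (cmod (f x))\<^sup>2) = (\<Sum>x\<in>?C. 1)"
    using C fin by (intro sum.mono_neutral_cong_right) (auto simp: f_def)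
  then have norm_f: "(\<Sum>x\<in>carrier G. (cmod (f x))\<^sup>2) = real (card ?C)" by simp
  have "(\<Sum>\<chi>\<in>Irr G. (real (card ?C) * cmod (\<chi> h))\<^sup>2) =
      (\<Sum>\<chi>\<in>Irr G. (cmod (\<Sum>x\<in>carrier G. f x * cnj (\<chi> x)))\<^sup>2)"
    by (intro sum.cong refl) (simp add: inner norm_mult)
  also have "\<dots> \<le> ?N * (\<Sum>x\<in>carrier G. (cmod (f x))\<^sup>2)"
    by (rule Bessel_inequality[OF finI N0]) (rule ortho)
  finally have "(card ?C)\<^sup>2 * (\<Sum>\<chi>\<in>Irr G. (cmod (\<chi> h))\<^sup>2) \<le> ?N * card ?C"
    by (simp add: norm_f power_mult_distrib sum_distrib_left)
  then show ?thesis
    using C0 by (simp add: field_simps power2_eq_square)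
qed

text \<open>After the triangle inequality and an exchange of sums, Cauchy-Schwarz separates the
  values at the neutral element from those at \<open>h\<close>. The class of the neutral element is
  a singleton, so the two factors multiply to \<open>|G|\<close> over the root of the class size,
  and \<open>|G|\<close> cancels against the normalisation.\<close>

lemma (in group) D_dist_le:
  assumes fin: "finite (carrier G)" and H: "H \<subseteq> carrier G"
  shows "D_dist G H \<le> (\<Sum>h\<in>H - {\<one>}. 1 / sqrt (card (conj_class G h)))"
proof (cases "finite (Irr G)")
  case True
  let ?N = "real (card (carrier G))"
  have N0: "?N > 0" using fin one_closed by (auto simp: card_gt_0_iff)
  have one: "conj_class G \<one> = {\<one>}" by (auto simp: conj_class_def)
  have each: "(\<Sum>\<chi>\<in>Irr G. cmod (\<chi> \<one>) * cmod (\<chi> h)) \<le> ?N * (1 / sqrt (card (conj_class G h)))"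
    if h: "h \<in> carrier G" for h
  proof -
    have "(\<Sum>\<chi>\<in>Irr G. cmod (\<chi> \<one>) * cmod (\<chi> h)) \<le>
        L2_set (\<lambda>\<chi>. cmod (\<chi> \<one>)) (Irr G) * L2_set (\<lambda>\<chi>. cmod (\<chi> h)) (Irr G)"
      using L2_set_mult_ineq[of "\<lambda>\<chi>. cmod (\<chi> \<one>)" "\<lambda>\<chi>. cmod (\<chi> h)" "Irr G"] by simp
    also have "\<dots> \<le> sqrt ?N * sqrt (?N / card (conj_class G h))"
      unfolding L2_set_def
      using sum_Irr_norm_square_le[OF fin True one_closed] sum_Irr_norm_square_le[OF fin True h]
      by (intro mult_mono) (auto simp: one intro!: sum_nonneg)
    also have "\<dots> = ?N * (1 / sqrt (card (conj_class G h)))"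
      using N0 by (simp add: real_sqrt_divide)
    finally show ?thesis .
  qed
  have "(\<Sum>\<chi>\<in>Irr G. cmod (\<chi> \<one>) * cmod (\<Sum>h\<in>H - {\<one>}. \<chi> h)) \<le>
      (\<Sum>\<chi>\<in>Irr G. \<Sum>h\<in>H - {\<one>}. cmod (\<chi> \<one>) * cmod (\<chi> h))"
    by (intro sum_mono) (auto simp: sum_distrib_left[symmetric] intro!: mult_left_mono norm_sum)
  also have "\<dots> = (\<Sum>h\<in>H - {\<one>}. \<Sum>\<chi>\<in>Irr G. cmod (\<chi> \<one>) * cmod (\<chi> h))"
    by (rule sum.swap)
  also have "\<dots> \<le> (\<Sum>h\<in>H - {\<one>}. ?N * (1 / sqrt (card (conj_class G h))))"
    using H by (intro sum_mono each) auto
  also have "\<dots> = ?N * (\<Sum>h\<in>H - {\<one>}. 1 / sqrt (card (conj_class G h)))"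
    by (rule sum_distrib_left[symmetric])
  finally show ?thesis
    using N0 by (simp add: D_dist_def pos_divide_le_eq mult.commute)
next
  \<comment> \<open>A sum over an infinite set is \<open>0\<close>, so finiteness of \<open>Irr G\<close> need not be proved.\<close>
  case False
  then show ?thesis by (simp add: D_dist_def sum_nonneg)
qed

section \<open>Conjugacy classes in the symmetric group\<close>

text \<open>The complements of \<open>D\<close> and of its image in \<open>S\<close> have equal
  size, and any bijection between them completes \<open>q\<close>.\<close>

lemma inj_on_extend_permutes:
  assumes fin: "finite S" and D: "D \<subseteq> S" and q: "inj_on q D" "q ` D \<subseteq> S"
  shows "\<exists>\<sigma>. \<sigma> permutes S \<and> (\<forall>x\<in>D. \<sigma> x = q x)"
proof -
  have "card (S - D) = card (S - q ` D)"
    using fin D q finite_subset[OF D fin] by (simp add: card_Diff_subset card_image)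
  then obtain g where g: "bij_betw g (S - D) (S - q ` D)"
    using finite_same_card_bij[of "S - D" "S - q ` D"] fin by auto
  define \<sigma> where "\<sigma> = (\<lambda>x. if x \<in> S then if x \<in> D then q x else g x else x)"
  have "bij_betw (\<lambda>x. if x \<in> D then q x else g x) (D \<union> (S - D)) (q ` D \<union> (S - q ` D))"
    using q(1) g by (intro bij_betw_disjoint_Un) (auto simp: bij_betw_def)
  then have "bij_betw (\<lambda>x. if x \<in> D then q x else g x) S S"
    using D q(2) by (simp add: Un_absorb1)
  then have "bij_betw \<sigma> S S"
    by (subst bij_betw_cong[of S \<sigma>]) (auto simp: \<sigma>_def)
  then have "\<sigma> permutes S"
    by (rule bij_imp_permutes) (simp add: \<sigma>_def)
  moreover have "\<sigma> x = q x" if "x \<in> D" for x using that D by (auto simp: \<sigma>_def)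
  ultimately show ?thesis by blast
qed

text \<open>A conjugate of \<open>h\<close> by a permutation fixing \<open>A\<close> pointwise can map \<open>A\<close> into its complement
  by an arbitrary injection.\<close>

lemma card_conj_class_sym_group_ge:
  assumes h: "h permutes {1..n}" and A: "A \<subseteq> {1..n}" "h ` A \<inter> A = {}"
  shows "(n - 2 * card A) ^ card A \<le> card (conj_class (sym_group n) h)"
proof -
  let ?C = "conj_class (sym_group n) h" and ?B = "{1..n} - A" and ?r = "card A"
  interpret group "sym_group n" by (rule sym_group_is_group)
  have finA: "finite A" using A(1) finite_subset by blast
  have fin: "finite (carrier (sym_group n))"
    by (simp add: sym_group_def finite_permutations)
  then have finC: "finite ?C" by (simp add: conj_class_def)
  \<comment> \<open>Every injection of \<open>A\<close> into its complement will be the restriction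
    of some conjugate of \<open>h\<close>, so the class is at least as large as
    \<open>F\<close>.\<close>
  define F where "F = {f \<in> A \<rightarrow>\<^sub>E ?B. inj_on f A}"
  have "F \<subseteq> (\<lambda>p. restrict p A) ` ?C"
  proof
    fix f assume "f \<in> F"
    then have f: "f \<in> A \<rightarrow>\<^sub>E ?B" "inj_on f A" by (auto simp: F_def)
    \<comment> \<open>A conjugator that fixes each \<open>a\<close> in \<open>A\<close> and sends
      \<open>h a\<close> to \<open>f a\<close> gives a conjugate taking \<open>a\<close> to
      \<open>f a\<close>. The two requirements are compatible because \<open>h\<close> moves
      \<open>A\<close> off itself.\<close>
    define q where "q = (\<lambda>x. if x \<in> A then x else f (Hilbert_Choice.inv h x))"
    have hinv: "Hilbert_Choice.inv h (h x) = x" for x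
      using permutes_inverses(2)[OF h] .
    have qh: "q (h a) = f a" if "a \<in> A" for a
      using that A(2) by (auto simp: q_def hinv)
    have "\<exists>\<sigma>. \<sigma> permutes {1..n} \<and> (\<forall>x\<in>A \<union> h ` A. \<sigma> x = q x)"
    proof (rule inj_on_extend_permutes)
      show "A \<union> h ` A \<subseteq> {1..n}"
        using A(1) permutes_in_image[OF h] by auto
      show "q ` (A \<union> h ` A) \<subseteq> {1..n}"
      proof -
        have "q ` (h ` A) = f ` A" using qh by (simp add: image_image)
        moreover have "q ` A = A" by (simp add: q_def)
        moreover have "f ` A \<subseteq> {1..n}" using f(1) by (auto simp: PiE_iff)
        ultimately show ?thesis using A(1) by (simp only: image_Un Un_least)
      qed
      have "inj_on q A" by (simp add: inj_on_def q_def)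
      moreover have "inj_on q (h ` A)"
        using f(2) qh by (auto simp: inj_on_def)
      moreover have "q ` A = A" by (simp add: q_def)
      moreover have "q ` (h ` A) \<subseteq> ?B"
        using f(1) qh by (auto simp: PiE_iff)
      ultimately show "inj_on q (A \<union> h ` A)"
        unfolding inj_on_Un by blast
    qed simp
    then obtain \<sigma> where \<sigma>: "\<sigma> permutes {1..n}" "\<And>x. x \<in> A \<union> h ` A \<Longrightarrow> \<sigma> x = q x"
      by blast
    have \<sigma>c: "\<sigma> \<in> carrier (sym_group n)" using \<sigma>(1) by (simp add: sym_group_carrier)
    define p where "p = \<sigma> \<otimes>\<^bsub>sym_group n\<^esub> h \<otimes>\<^bsub>sym_group n\<^esub> inv\<^bsub>sym_group n\<^esub> \<sigma>"
    have "p \<in> ?C" unfolding p_def conj_class_def using \<sigma>c by blast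
    moreover have "restrict p A = f"
    proof
      fix a show "restrict p A a = f a"
      proof (cases "a \<in> A")
        case True
        have "\<sigma> a = a" using \<sigma>(2)[of a] True by (simp add: q_def)
        then have "Hilbert_Choice.inv \<sigma> a = a"
          using permutes_inverses(2)[OF \<sigma>(1), of a] by simp
        then have "p a = \<sigma> (h a)"
          by (simp add: p_def sym_group_mult sym_group_inv_equality[OF \<sigma>c])
        also have "\<dots> = f a" using \<sigma>(2)[of "h a"] True qh by simp
        finally show ?thesis using True by simp
      qed (use f(1) in \<open>simp add: PiE_iff extensional_def\<close>)
    qed
    ultimately show "f \<in> (\<lambda>p. restrict p A) ` ?C" by blast
  qed
  then have "card F \<le> card ?C"
    using finC by (meson card_image_le card_mono finite_imageI le_trans)
  moreover have "card F = (\<Prod>i = 0..<?r. card ?B - i)"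
    unfolding F_def using card_inj_on_subset_funcset[OF finA, of ?B A] by simp
  \<comment> \<open>The complement of \<open>A\<close> has \<open>n - card A\<close> points and
    \<open>i < card A\<close>, so every factor is at least \<open>n - 2 * card A\<close>.\<close>
  moreover have "(\<Prod>i = 0..<?r. n - 2 * ?r) \<le> (\<Prod>i = 0..<?r. card ?B - i)"
    using A(1) finA by (intro prod_mono) (auto simp: card_Diff_subset)
  ultimately show ?thesis by simp
qed

text \<open>Take \<open>A\<close> maximal. A moved point outside \<open>A\<close>, its image and its
  preimage could be added to \<open>A\<close>, so these three sets cover the support. A 3-cycle
  shows that the factor 3 is sharp.\<close>

lemma exists_disjoint_image_subset:
  assumes p: "p permutes S" and fin: "finite S"
  shows "\<exists>A \<subseteq> {x. p x \<noteq> x}. p ` A \<inter> A = {} \<and> card {x. p x \<noteq> x} \<le> 3 * card A"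
proof -
  let ?U = "{x. p x \<noteq> x}"
  have "?U \<subseteq> S" using permutes_not_in[OF p] by auto
  then have finU: "finite ?U" using fin finite_subset by blast
  define \<A> where "\<A> = {A. A \<subseteq> ?U \<and> p ` A \<inter> A = {}}"
  have "finite \<A>" using finU by (auto simp: \<A>_def intro: finite_subset[of _ "Pow ?U"])
  moreover have "{} \<in> \<A>" by (simp add: \<A>_def)
  ultimately obtain A where A: "A \<in> \<A>" and max: "\<And>B. B \<in> \<A> \<Longrightarrow> A \<subseteq> B \<Longrightarrow> A = B"
    using finite_has_maximal[of \<A>] by blast
  have finA: "finite A" using A finU finite_subset by (auto simp: \<A>_def)
  let ?i = "Hilbert_Choice.inv p"
  have "?U \<subseteq> A \<union> p ` A \<union> ?i ` A"
  proof (rule ccontr)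
    assume "\<not> ?thesis"
    then obtain x where x: "p x \<noteq> x" "x \<notin> A" "x \<notin> p ` A" "x \<notin> ?i ` A" by blast
    have "p x \<notin> A" using x(4) permutes_inverses(2)[OF p, of x] by force
    then have "insert x A \<in> \<A>" using A x by (auto simp: \<A>_def)
    then show False using max[of "insert x A"] x(2) by blast
  qed
  then have "card ?U \<le> card (A \<union> p ` A \<union> ?i ` A)"
    using finA by (intro card_mono) auto
  also have "\<dots> \<le> card A + card (p ` A) + card (?i ` A)"
    by (meson add_le_mono1 card_Un_le le_trans)
  also have "\<dots> \<le> 3 * card A"
    using card_image_le[OF finA, of p] card_image_le[OF finA, of ?i] by simp
  finally show ?thesis using A by (auto simp: \<A>_def)
qed

section \<open>Diagonal subgroups\<close>

text \<open>The diagonal action of permutations of \<open>{1..k}\<close> on \<open>m\<close> disjoint copies of \<open>{1..k}\<close>, the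
  \<open>j\<close>-th copy being \<open>{1 + k * j..k + k * j}\<close>.\<close>

definition diag_perm :: "nat \<Rightarrow> nat \<Rightarrow> (nat \<Rightarrow> nat) \<Rightarrow> nat \<Rightarrow> nat" where
  "diag_perm k m p x =
     (if x \<in> {1..k * m} then p ((x - 1) mod k + 1) + k * ((x - 1) div k) else x)"

text \<open>Points are 1-based while copies are numbered from 0. The shift by 1 keeps the last point
  \<open>k\<close> of a copy from being counted in the next one.\<close>

lemma block_index:
  fixes i j k :: nat
  assumes "i \<in> {1..k}"
  shows "(i + k * j - 1) mod k + 1 = i" "(i + k * j - 1) div k = j"
proof -
  obtain i' where "i = Suc i'" "i' < k" using assms by (cases i) auto
  then show "(i + k * j - 1) mod k + 1 = i" "(i + k * j - 1) div k = j"
    by auto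
qed

lemma block_in_range:
  fixes i j k m :: nat
  assumes "i \<in> {1..k}" "j < m"
  shows "i + k * j \<in> {1..k * m}"
proof -
  have "i + k * j \<le> k + k * j" using assms by simp
  also have "\<dots> = k * Suc j" by simp
  also have "\<dots> \<le> k * m" using assms(2) by (intro mult_le_mono2) simp
  finally show ?thesis using assms by simp
qed

lemma block_cases:
  fixes k m x :: nat
  assumes "x \<in> {1..k * m}"
  obtains i j where "i \<in> {1..k}" "j < m" "x = i + k * j"
proof
  have "k > 0" using assms by (cases k) auto
  then show "(x - 1) mod k + 1 \<in> {1..k}" by (auto simp: Suc_le_eq)
  show "(x - 1) div k < m"
    using assms by (intro less_mult_imp_div_less) (auto simp: mult.commute)
  show "x = (x - 1) mod k + 1 + k * ((x - 1) div k)"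
    using assms by simp
qed

lemma diag_perm_block:
  assumes "i \<in> {1..k}" "j < m"
  shows "diag_perm k m p (i + k * j) = p i + k * j"
  using assms block_in_range[OF assms] block_index[OF assms(1), of j]
  unfolding diag_perm_def by simp

lemma diag_perm_compose:
  assumes "q permutes {1..k}"
  shows "diag_perm k m (p \<circ> q) = diag_perm k m p \<circ> diag_perm k m q"
proof
  fix x show "diag_perm k m (p \<circ> q) x = (diag_perm k m p \<circ> diag_perm k m q) x"
  proof (cases "x \<in> {1..k * m}")
    case True
    then obtain i j where ij: "i \<in> {1..k}" "j < m" "x = i + k * j" by (rule block_cases)
    then have "q i \<in> {1..k}" using permutes_in_image[OF assms] by blast
    then show ?thesis using ij by (simp add: diag_perm_block)
  next
    case False
    then have "diag_perm k m r x = x" for r by (simp only: diag_perm_def if_False)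
    then show ?thesis by simp
  qed
qed

lemma diag_perm_id [simp]: "diag_perm k m id = id"
proof
  fix x show "diag_perm k m id x = id x"
  proof (cases "x \<in> {1..k * m}")
    case True
    then obtain i j where "i \<in> {1..k}" "j < m" "x = i + k * j" by (rule block_cases)
    then show ?thesis by (simp add: diag_perm_block)
  qed (simp only: diag_perm_def if_False id_apply)
qed

lemma diag_perm_permutes:
  assumes p: "p permutes {1..k}"
  shows "diag_perm k m p permutes {1..k * m}"
proof -
  let ?i = "Hilbert_Choice.inv p"
  have "diag_perm k m p \<circ> diag_perm k m ?i = id" "diag_perm k m ?i \<circ> diag_perm k m p = id"
    using diag_perm_compose[OF p, of m ?i] diag_perm_compose[OF permutes_inv[OF p], of m p]
    by (simp_all add: permutes_inv_o[OF p])
  then have "bij (diag_perm k m p)" using o_bij by blast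
  moreover have "\<forall>x. x \<notin> {1..k * m} \<longrightarrow> diag_perm k m p x = x"
    by (auto simp: diag_perm_def)
  ultimately show ?thesis unfolding permutes_def bij_iff by blast
qed

lemma inj_on_diag_perm:
  assumes "m > 0"
  shows "inj_on (diag_perm k m) {p. p permutes {1..k}}"
proof (rule inj_onI, rule ext)
  fix p q x
  assume pq: "p \<in> {p. p permutes {1..k}}" "q \<in> {p. p permutes {1..k}}"
    and eq: "diag_perm k m p = diag_perm k m q"
  show "p x = q x"
  proof (cases "x \<in> {1..k}")
    case True
    then show ?thesis
      \<comment> \<open>Copy 0 exists because \<open>m > 0\<close>, and it already shows all of
        \<open>p\<close>.\<close>
      using fun_cong[OF eq, of "x + k * 0"] assms diag_perm_block[of x k 0 m] by simp
  next
    case False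
    then show ?thesis using pq by (auto simp: permutes_def)
  qed
qed

definition diag_subgroup :: "nat \<Rightarrow> nat \<Rightarrow> (nat \<Rightarrow> nat) set" where
  "diag_subgroup k m = diag_perm k m ` {p. p permutes {1..k}}"

lemma subgroup_diag_subgroup: "subgroup (diag_subgroup k m) (sym_group (k * m))"
proof -
  have "group_hom (sym_group k) (sym_group (k * m)) (diag_perm k m)"
    by (intro group_hom.intro group_hom_axioms.intro sym_group_is_group homI)
       (auto simp: sym_group_carrier sym_group_mult diag_perm_permutes diag_perm_compose
          simp del: One_nat_def)
  from group_hom.img_is_subgroup[OF this] show ?thesis
    by (simp add: diag_subgroup_def sym_group_def)
qed

lemma card_diag_subgroup: "m > 0 \<Longrightarrow> card (diag_subgroup k m) = fact k"
  unfolding diag_subgroup_def by (simp add: card_image inj_on_diag_perm card_permutations del: One_nat_def)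

text \<open>Repeating \<open>A\<close> in each of the \<open>3 l\<close> copies gives a set disjoint
  from its image; the 3 makes up for the loss in choosing \<open>A\<close>, leaving at least
  \<open>l s\<close> points for a support of size \<open>s\<close>. As \<open>s\<close> is at most
  \<open>k\<close>, removing \<open>2 l s\<close> of the \<open>3 l k\<close> points leaves at least
  \<open>l k\<close>.\<close>

lemma card_conj_class_diag_perm_ge:
  assumes p: "p permutes {1..k}"
  shows "(l * k) ^ (l * card {x. p x \<noteq> x}) \<le>
           card (conj_class (sym_group (k * (3 * l))) (diag_perm k (3 * l) p))"
proof -
  let ?s = "card {x. p x \<noteq> x}" and ?m = "3 * l"
  have U: "{x. p x \<noteq> x} \<subseteq> {1..k}" using permutes_not_in[OF p] by blast
  then have "?s \<le> card {1..k}" by (intro card_mono) auto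
  then have s: "?s \<le> k" by simp
  obtain A where A: "A \<subseteq> {x. p x \<noteq> x}" "p ` A \<inter> A = {}" "?s \<le> 3 * card A"
    using exists_disjoint_image_subset[OF p] by auto
  have Ak: "A \<subseteq> {1..k}" using A(1) U by blast
  define B where "B = (\<lambda>(i, j). i + k * j) ` (A \<times> {..<?m})"
  have inj: "inj_on (\<lambda>(i, j). i + k * j) (A \<times> {..<?m})"
  proof (rule inj_onI, clarify)
    fix i j i' j'
    assume "i \<in> A" "i' \<in> A" and eq: "i + k * j = i' + k * j'"
    then have "i \<in> {1..k}" "i' \<in> {1..k}" using Ak by auto
    then show "i = i' \<and> j = j'"
      using block_index[of i k j] block_index[of i' k j'] eq by simp
  qed
  have B: "B \<subseteq> {1..k * ?m}"
  proof
    fix x assume "x \<in> B"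
    then obtain i j where "i \<in> A" "j < ?m" "x = i + k * j" unfolding B_def by auto
    then show "x \<in> {1..k * ?m}" using Ak block_in_range[of i k j ?m] by blast
  qed
  have disj: "diag_perm k ?m p ` B \<inter> B = {}"
  proof (rule ccontr)
    assume "\<not> ?thesis"
    then obtain i j i' j' where ij: "i \<in> A" "j < ?m" "i' \<in> A" "j' < ?m"
      and eq: "diag_perm k ?m p (i + k * j) = i' + k * j'"
      unfolding B_def by auto
    have r: "i \<in> {1..k}" "i' \<in> {1..k}" using ij Ak by auto
    then have "p i + k * j = i' + k * j'" using eq ij by (simp add: diag_perm_block)
    moreover have "p i \<in> {1..k}" using r(1) permutes_in_image[OF p] by blast
    ultimately have "p i = i'"
      using block_index(1)[of "p i" k j] block_index(1)[OF r(2), of j'] by simp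
    then show False using A(2) ij by blast
  qed
  have "card B = card A * ?m"
    unfolding B_def card_image[OF inj] card_cartesian_product by simp
  then have "l * ?s \<le> card B" using A(3) by simp
  \<comment> \<open>The set is cut down to exactly \<open>l * ?s\<close> points because the base of
    the power shrinks as the set grows; for all of \<open>B\<close> it can be 0.\<close>
  then obtain C where C: "C \<subseteq> B" "card C = l * ?s"
    by (metis obtain_subset_with_card_n)
  have conj: "(k * ?m - 2 * card C) ^ card C \<le> card (conj_class (sym_group (k * ?m)) (diag_perm k ?m p))"
    using C(1) B disj by (intro card_conj_class_sym_group_ge diag_perm_permutes p) auto
  have "l * k \<le> k * ?m - 2 * card C"
  proof -
    have "l * ?s \<le> l * k" using s by simp
    moreover have "k * ?m = 3 * (l * k)" by simp
    ultimately show ?thesis unfolding C(2) by linarith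
  qed
  then have "(l * k) ^ card C \<le> (k * ?m - 2 * card C) ^ card C" by (rule power_mono) simp
  from order_trans[OF this conj] show ?thesis by (simp only: C(2))
qed

text \<open>Enlarging the range of summation from permutations to all maps of \<open>{1..k}\<close>
  to itself makes the sum factor over the points: each contributes 1 for staying fixed and
  \<open>q\<close> for each other value.\<close>

lemma sum_power_card_support_le:
  fixes q :: real
  assumes "q \<ge> 0"
  shows "(\<Sum>p | p permutes {1..k}. q ^ card {x. p x \<noteq> x}) \<le> (1 + real k * q) ^ k"
proof -
  define w where "w = (\<lambda>x y :: nat. if y = x then 1 else q)"
  let ?K = "{1..k}"
  have "(\<Sum>p | p permutes ?K. q ^ card {x. p x \<noteq> x}) =
      (\<Sum>p | p permutes ?K. \<Prod>x\<in>?K. w x (restrict p ?K x))"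
  proof (intro sum.cong refl)
    fix p assume "p \<in> {p. p permutes ?K}"
    then have "{x. p x \<noteq> x} = {x \<in> ?K. p x \<noteq> x}" by (auto simp: permutes_def)
    then have "q ^ card {x. p x \<noteq> x} = (\<Prod>x | x \<in> ?K \<and> p x \<noteq> x. q)" by simp
    also have "\<dots> = (\<Prod>x\<in>?K. w x (restrict p ?K x))"
      by (intro prod.mono_neutral_cong_left) (auto simp: w_def)
    finally show "q ^ card {x. p x \<noteq> x} = (\<Prod>x\<in>?K. w x (restrict p ?K x))" .
  qed
  \<comment> \<open>Restriction matches permutations, which are the identity outside
    \<open>{1..k}\<close>, with the extensional functions of the product space.\<close>
  also have "\<dots> = (\<Sum>g\<in>(\<lambda>p. restrict p ?K) ` {p. p permutes ?K}. \<Prod>x\<in>?K. w x (g x))"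
  proof (subst sum.reindex)
    show "inj_on (\<lambda>p. restrict p ?K) {p. p permutes ?K}"
    proof (rule inj_onI, rule ext)
      fix p r x assume "p \<in> {p. p permutes ?K}" "r \<in> {p. p permutes ?K}"
        "restrict p ?K = restrict r ?K"
      then show "p x = r x"
        by (cases "x \<in> ?K") (auto simp: permutes_def dest: fun_cong[of _ _ x] split: if_splits)
    qed
  qed simp
  also have "\<dots> \<le> (\<Sum>g\<in>?K \<rightarrow>\<^sub>E ?K. \<Prod>x\<in>?K. w x (g x))"
  proof (intro sum_mono2 prod_nonneg)
    show "(\<lambda>p. restrict p ?K) ` {p. p permutes ?K} \<subseteq> ?K \<rightarrow>\<^sub>E ?K"
      using permutes_in_image by fastforce
  qed (use assms in \<open>auto simp: w_def intro!: finite_PiE\<close>)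
  also have "\<dots> = (\<Prod>x\<in>?K. \<Sum>y\<in>?K. w x y)"
    by (rule prod_sum_PiE[symmetric]) auto
  also have "\<dots> \<le> (\<Prod>x\<in>?K. 1 + real k * q)"
  proof (intro prod_mono conjI)
    fix x assume x: "x \<in> ?K"
    have "(\<Sum>y\<in>?K. w x y) = 1 + (\<Sum>y\<in>?K - {x}. q)"
      using x by (subst sum.remove[of _ x]) (auto simp: w_def)
    also have "\<dots> = 1 + real (k - 1) * q" using x by simp
    also have "\<dots> \<le> 1 + real k * q"
      using assms by (intro add_left_mono mult_right_mono) auto
    finally show "(\<Sum>y\<in>?K. w x y) \<le> 1 + real k * q" .
    show "0 \<le> (\<Sum>y\<in>?K. w x y)" using assms by (auto simp: w_def intro!: sum_nonneg)
  qed
  finally show ?thesis by simp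
qed

text \<open>With \<open>6 L = 3 (2 L)\<close> copies the class bound has exponent
  \<open>2 L s\<close>, and its square root still gives \<open>k\<close> to the power
  \<open>L s\<close>. So each element costs at most \<open>q ^ s\<close>, and summing over supports
  leaves about \<open>k\<^sup>2 q\<close>.\<close>

lemma D_dist_diag_subgroup_le:
  assumes L: "L \<ge> 2" and k: "k \<ge> 1"
  shows "D_dist (sym_group (k * (6 * L))) (diag_subgroup k (6 * L)) \<le> 2 * real k ^ 2 / real k ^ L"
proof -
  let ?G = "sym_group (k * (6 * L))" and ?P = "{p. p permutes {1..k}}" and ?m = "6 * L"
  interpret group ?G by (rule sym_group_is_group)
  have fin: "finite (carrier ?G)" by (simp add: sym_group_def finite_permutations)
  define q where "q = 1 / real k ^ L"
  have q: "q \<ge> 0" by (simp add: q_def)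
  have finP: "finite ?P" by (simp add: finite_permutations)
  have inj: "inj_on (diag_perm k ?m) ?P" using L by (intro inj_on_diag_perm) simp
  have "diag_subgroup k ?m - {\<one>\<^bsub>?G\<^esub>} = diag_perm k ?m ` (?P - {id})"
    unfolding diag_subgroup_def sym_group_one
    using inj_on_image_set_diff[OF inj, of ?P "{id}"] permutes_id by force
  then have "D_dist ?G (diag_subgroup k ?m) \<le>
      (\<Sum>h\<in>diag_perm k ?m ` (?P - {id}). 1 / sqrt (card (conj_class ?G h)))"
    using D_dist_le[OF fin subgroup.subset[OF subgroup_diag_subgroup]] by simp
  also have "\<dots> = (\<Sum>p\<in>?P - {id}. 1 / sqrt (card (conj_class ?G (diag_perm k ?m p))))"
    using inj by (subst sum.reindex) (auto intro: inj_on_subset)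
  also have "\<dots> \<le> (\<Sum>p\<in>?P - {id}. q ^ card {x. p x \<noteq> x})"
  proof (intro sum_mono)
    fix p assume "p \<in> ?P - {id}"
    then have p: "p permutes {1..k}" by simp
    let ?s = "card {x. p x \<noteq> x}"
    have "(real k ^ (L * ?s))\<^sup>2 = real (k ^ (2 * L * ?s))"
      by (simp add: power_mult[symmetric] mult_ac)
    also have "\<dots> \<le> real ((2 * L * k) ^ (2 * L * ?s))"
      using L by (intro of_nat_mono power_mono) auto
    also have "\<dots> \<le> real (card (conj_class ?G (diag_perm k ?m p)))"
      using card_conj_class_diag_perm_ge[OF p, of "2 * L"] by (intro of_nat_mono) simp
    finally have "real k ^ (L * ?s) \<le> sqrt (card (conj_class ?G (diag_perm k ?m p)))"
      by (rule real_le_rsqrt)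
    then have "1 / sqrt (card (conj_class ?G (diag_perm k ?m p))) \<le> 1 / real k ^ (L * ?s)"
      using k by (intro frac_le) auto
    then show "1 / sqrt (card (conj_class ?G (diag_perm k ?m p))) \<le> q ^ ?s"
      by (simp add: q_def power_one_over power_mult)
  qed
  \<comment> \<open>The subtracted 1 is the contribution of the identity, whose support is
    empty.\<close>
  also have "\<dots> = (\<Sum>p\<in>?P. q ^ card {x. p x \<noteq> x}) - 1"
    using finP permutes_id by (subst sum.remove[of ?P id]) auto
  also have "\<dots> \<le> (1 + real k * q) ^ k - 1"
    using sum_power_card_support_le[OF q, of k] by simp
  also have "\<dots> \<le> exp (real k * q) ^ k - 1"
    using q by (intro diff_right_mono power_mono exp_ge_add_one_self) auto
  also have "\<dots> = exp (real k ^ 2 * q) - 1"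
    by (simp add: exp_of_nat_mult[symmetric] power2_eq_square mult_ac)
  \<comment> \<open>From \<open>L \<ge> 2\<close> the exponent is at most 1, where the quadratic
    bound for \<open>exp\<close> applies.\<close>
  also have "\<dots> \<le> 2 * (real k ^ 2 * q)"
  proof -
    have "real k ^ 2 \<le> real k ^ L" using L k by (intro power_increasing) auto
    then have y: "real k ^ 2 * q \<le> 1" using k by (simp add: q_def)
    then have "exp (real k ^ 2 * q) \<le> 1 + real k ^ 2 * q + (real k ^ 2 * q)\<^sup>2"
      using q by (intro exp_bound) auto
    also have "(real k ^ 2 * q)\<^sup>2 \<le> (real k ^ 2 * q) * 1"
      unfolding power2_eq_square[of "real k ^ 2 * q"] using y q by (intro mult_left_mono) auto
    finally show ?thesis by (simp add: mult.commute)
  qed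
  finally show ?thesis by (simp add: q_def)
qed

section \<open>Asymptotics\<close>

text \<open>Pairing the factor \<open>i + 1\<close> with \<open>k - i\<close> gives a product of at
  least \<open>k\<close>, so the square of \<open>k!\<close> is at least
  \<open>k ^ k\<close>.\<close>

lemma ln_fact_ge: "real k * ln (real k) \<le> 2 * ln (fact k)"
proof (cases "k = 0")
  case False
  have "k ^ k = (\<Prod>i = 0..<k. k)" by simp
  also have "\<dots> \<le> (\<Prod>i = 0..<k. Suc i * (k - i))"
  proof (intro prod_mono conjI)
    fix i assume "i \<in> {0..<k}"
    then obtain j where "k = Suc (i + j)" by (auto simp: less_iff_Suc_add)
    then show "k \<le> Suc i * (k - i)" by simp
  qed simp
  also have "\<dots> = fact k * fact k"
    unfolding prod.distrib
    using fact_prod_Suc[of k, where ?'a = nat] fact_prod_rev[of k, where ?'a = nat]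
    by (simp only: of_nat_id)
  finally have "real (k ^ k) \<le> real (fact k * fact k)" by (rule of_nat_mono)
  then have "real k ^ k \<le> fact k * fact k" by simp
  then have "ln (real k ^ k) \<le> ln (fact k * fact k)"
    using False by (intro ln_mono) auto
  then show ?thesis using False by (simp add: ln_realpow ln_mult)
qed simp

lemma ln_fact_le: "ln (fact n) \<le> real n * ln (real n)"
proof (cases "n = 0")
  case False
  have "fact n \<le> real n ^ n"
    using fact_le_power[of n] by (metis of_nat_fact of_nat_le_iff of_nat_power le_refl)
  then have "ln (fact n) \<le> ln (real n ^ n)" by (intro ln_mono) auto
  then show ?thesis using False by (simp add: ln_realpow)
qed simp

text \<open>The constant is \<open>24 = 6 * 2 * 2\<close>: there are \<open>6 L\<close> copies,
  \<open>n\<close> is at most \<open>k\<^sup>2\<close> because \<open>k \<ge> 6 L\<close>, and the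
  lower bound for \<open>ln (fact k)\<close> loses another factor 2.\<close>

lemma fact_powr_le_card_diag_subgroup:
  assumes L: "L \<ge> 1" and k: "k \<ge> 6 * L" and e: "e \<le> 1 / (24 * real L)"
  shows "fact (k * (6 * L)) powr e \<le> real (card (diag_subgroup k (6 * L)))"
proof -
  let ?n = "k * (6 * L)"
  have k0: "k > 0" using L k by simp
  have "e * ln (fact ?n) \<le> 1 / (24 * real L) * ln (fact ?n)"
    using e by (intro mult_right_mono) (auto simp: ln_ge_zero)
  also have "\<dots> \<le> 1 / (24 * real L) * (real ?n * ln (real ?n))"
    by (intro mult_left_mono ln_fact_le) auto
  also have "\<dots> = real k / 4 * ln (real ?n)"
    using L by (simp add: field_simps)
  also have "\<dots> \<le> real k / 4 * ln (real k ^ 2)"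
  proof (intro mult_left_mono ln_mono)
    show "real ?n \<le> real k ^ 2"
      using k by (simp add: power2_eq_square flip: of_nat_mult)
    show "real ?n > 0" using k0 L by simp
  qed auto
  also have "\<dots> = real k * ln (real k) / 2"
    using k0 by (simp add: ln_realpow)
  also have "\<dots> \<le> ln (fact k)" using ln_fact_ge[of k] by simp
  finally have "exp (e * ln (fact ?n)) \<le> fact k"
    by (metis exp_le_cancel_iff exp_ln fact_gt_zero)
  then show ?thesis using L by (simp add: powr_def card_diag_subgroup)
qed

text \<open>With \<open>L = c + 4\<close> the distance is at most 2 over \<open>k ^ (c + 2)\<close>,
  whereas the \<open>b\<close>-th power of \<open>ln (fact n)\<close> is at most
  \<open>n ^ c\<close>, a constant times \<open>k ^ c\<close>. The lower bound on \<open>k\<close>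
  absorbs this constant.\<close>

lemma D_dist_diag_subgroup_less:
  assumes k: "k > 2 * (6 * (c + 4)) ^ c" and b: "0 < b" "2 * b \<le> real c"
    and n: "n = k * (6 * (c + 4))"
  shows "D_dist (sym_group n) (diag_subgroup k (6 * (c + 4))) < ln (fact n) powr (- b)"
proof -
  have k1: "k \<ge> 1" using k by simp
  have n2: "n \<ge> 2" using mult_le_mono[OF k1, of 2 "6 * (c + 4)"] by (simp add: n)
  have "fact 2 \<le> (fact n :: real)" using n2 by (rule fact_mono)
  then have ln0: "ln (fact n :: real) > 0" by (simp add: ln_gt_zero)
  have "ln (fact n) \<le> real n * ln (real n)" by (rule ln_fact_le)
  also have "\<dots> \<le> real n ^ 2"
    unfolding power2_eq_square using n2 ln_le_minus_one[of "real n"]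
    by (intro mult_left_mono) auto
  finally have "ln (fact n) powr b \<le> (real n ^ 2) powr b"
    using ln0 b by (intro powr_mono2) auto
  also have "\<dots> = real n powr (2 * b)"
    using n2 by (simp add: powr_powr flip: powr_numeral)
  also have "\<dots> \<le> real n powr real c"
    using b n2 by (intro powr_mono) auto
  also have "\<dots> = real n ^ c" using n2 by (simp add: powr_realpow)
  finally have *: "ln (fact n) powr b \<le> real n ^ c" .
  have "2 * n ^ c = k ^ c * (2 * (6 * (c + 4)) ^ c)"
    unfolding n power_mult_distrib by (simp add: mult_ac)
  also have "\<dots> < k ^ c * k" using k k1 by (intro mult_strict_left_mono) auto
  also have "\<dots> \<le> k ^ (c + 2)" using k1 by (simp add: power_add power2_eq_square)
  finally have "real (2 * n ^ c) < real (k ^ (c + 2))" by (simp only: of_nat_less_iff)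
  then have **: "2 * real n ^ c < real k ^ (c + 2)" by simp
  have "D_dist (sym_group n) (diag_subgroup k (6 * (c + 4))) \<le> 2 * real k ^ 2 / real k ^ (c + 4)"
    unfolding n using k1 by (intro D_dist_diag_subgroup_le) auto
  also have "\<dots> = 2 / real k ^ (c + 2)"
    using k1 by (simp add: power_add field_simps eval_nat_numeral)
  also have "\<dots> < 1 / real n ^ c"
    using ** n2 k1 by (simp add: field_simps)
  also have "\<dots> \<le> 1 / ln (fact n) powr b"
    using * ln0 by (intro frac_le) auto
  also have "\<dots> = ln (fact n) powr (- b)" by (simp add: powr_minus_divide)
  finally show ?thesis .
qed

section \<open>The family of minimising subgroups\<close>

theorem theorem4:
  fixes \<epsilon> :: "nat \<Rightarrow> real"
  assumes "\<epsilon> \<longlonglongrightarrow> 0"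
  shows "\<exists>n0 H. (\<forall>n \<ge> n0. subgroup (H n) (sym_group n) \<and>
                     real (card (H n)) \<ge> (fact n) powr (\<epsilon> n))
               \<and> \<not> sym_distinguishable n0 H"
proof -
  define ok where "ok = (\<lambda>n. {H. subgroup H (sym_group n) \<and> real (card H) \<ge> fact n powr \<epsilon> n})"
  have card_sym: "card (carrier (sym_group n)) = fact n" for n
    by (simp add: sym_group_def card_permutations del: One_nat_def)
  have fin_sym: "finite (carrier (sym_group n))" for n
    by (simp add: sym_group_def finite_permutations)
  have fin: "finite (ok n)" for n
    by (rule finite_subset[of _ "Pow (carrier (sym_group n))"])
       (use fin_sym in \<open>auto simp: ok_def dest: subgroup.subset\<close>)
  \<comment> \<open>Once the exponent is below 1 the whole symmetric group is large enough, so there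
    is a candidate to minimise over.\<close>
  obtain n0 where n0: "\<And>n. n \<ge> n0 \<Longrightarrow> \<epsilon> n < 1"
    using order_tendstoD(2)[OF assms, of 1] by (auto simp: eventually_sequentially)
  have ne: "ok n \<noteq> {}" if "n \<ge> n0" for n
  proof -
    have "carrier (sym_group n) \<in> ok n"
      using powr_mono[of "\<epsilon> n" 1 "fact n"] n0[OF that]
      by (auto simp: ok_def card_sym group.subgroup_self[OF sym_group_is_group])
    then show ?thesis by blast
  qed
  \<comment> \<open>The minimiser is chosen without reference to any exponent, so this one family
    can be tested against every \<open>b\<close>.\<close>
  define H where "H = (\<lambda>n. arg_min_on (D_dist (sym_group n)) (ok n))"
  have H: "H n \<in> ok n" if "n \<ge> n0" for n
    unfolding H_def by (rule arg_min_if_finite(1)[OF fin ne[OF that]])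
  have min: "D_dist (sym_group n) (H n) \<le> D_dist (sym_group n) K" if "n \<ge> n0" "K \<in> ok n" for n K
    unfolding H_def by (rule arg_min_least[OF fin ne[OF that(1)] that(2)])
  have "\<not> sym_distinguishable n0 H"
  proof
    assume "sym_distinguishable n0 H"
    then obtain b N where b: "b > 0"
      and D: "\<And>n. n \<ge> N \<Longrightarrow> n \<ge> n0 \<Longrightarrow> D_dist (sym_group n) (H n) \<ge> ln (fact n) powr (- b)"
      unfolding sym_distinguishable_def card_sym by auto
    obtain c :: nat where c: "2 * b \<le> real c" using real_arch_simple by blast
    define L where "L = c + 4"
    obtain n1 where n1: "\<And>n. n \<ge> n1 \<Longrightarrow> \<epsilon> n < 1 / (24 * real L)"
      using order_tendstoD(2)[OF assms, of "1 / (24 * real L)"]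
      by (auto simp: eventually_sequentially L_def)
    \<comment> \<open>A single \<open>n\<close> past the threshold contradicts distinguishability,
      so \<open>n\<close> may be taken as a multiple of \<open>6 * L\<close>. Since
      \<open>n \<ge> k\<close>, the bounds \<open>N\<close>, \<open>n0\<close>, \<open>n1\<close> on
      \<open>k\<close> pass to \<open>n\<close>; the last two entries serve the size and the
      distance estimates.\<close>
    define k where "k = Max {N, n0, n1, 6 * L, 2 * (6 * L) ^ c + 1}"
    have k: "k \<ge> N" "k \<ge> n0" "k \<ge> n1" "k \<ge> 6 * L" "k > 2 * (6 * L) ^ c"
      by (auto simp: k_def less_eq_Suc_le)
    define n where "n = k * (6 * L)"
    have "k \<le> n" by (simp add: n_def L_def)
    then have n: "n \<ge> N" "n \<ge> n0" "n \<ge> n1" using k by auto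
    have "fact n powr \<epsilon> n \<le> real (card (diag_subgroup k (6 * L)))"
      unfolding n_def
      by (rule fact_powr_le_card_diag_subgroup)
         (use k n1[OF n(3)] in \<open>auto simp: L_def n_def\<close>)
    then have "diag_subgroup k (6 * L) \<in> ok n"
      by (simp add: ok_def subgroup_diag_subgroup n_def)
    then have "D_dist (sym_group n) (H n) \<le> D_dist (sym_group n) (diag_subgroup k (6 * L))"
      by (rule min[OF n(2)])
    also have "\<dots> < ln (fact n) powr (- b)"
      unfolding L_def
      by (rule D_dist_diag_subgroup_less) (use k b c in \<open>auto simp: L_def n_def\<close>)
    finally show False using D[OF n(1,2)] by simp
  qed
  moreover have "\<forall>n \<ge> n0. subgroup (H n) (sym_group n) \<and> real (card (H n)) \<ge> fact n powr \<epsilon> n"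
    using H by (auto simp: ok_def)
  ultimately show ?thesis by blast
qed

end
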